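(* Let $\mathcal{P}$ be a well-formed integer program and let $\alpha_1,\alpha_2\in\mathcal{P}$ with \[ \alpha_1: f_1(\vec x)\xrightarrow{c_1}S\ [\varphi_1]\ \text{ where } f_2(\vec x)\mu\in S,\qquad \alpha_2: f_2(\vec x)\xrightarrow{c_2}T\ [\varphi_2], \] and $\mathcal{TV}(\alpha_1)\cap\mathcal{TV}(\alpha_2)=\emptyset$. Let $\alpha_{1.2}$ be the rule \[ f_1(\vec x)\xrightarrow{c_1+c_2\mu}(S\setminus\{f_2(\vec x)\mu\})\cup T\mu\ [\varphi_1\land\varphi_2\mu] \] and $\mathcal{P}'=\mathcal{P}\cup\{\alpha_{1.2}\}$. Then $\mathcal{P}'$ is well formed and the processor mapping $\mathcal{P}$ to $\mathcal{P}'$ is sound.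
   Context: Fix a finite set $\Sigma$ of function symbols of common arity $k$ containing a start symbol $f_0$, and variables ranging over $\mathbb{Z}$. Arithmetic expressions are built from variables, numbers and operations such as $+,-,\cdot$, division, exponentiation; a constraint is a finite conjunction of inequations between arithmetic expressions. A rule has the form $f(\vec x)\xrightarrow{c}T\ [\varphi]$ where $\vec x=(x_1,\dots,x_k)$ is a fixed vector of pairwise different program variables, $f\in\Sigma$, $c$ an arithmetic expression (cost), $T$ a finite multiset of terms $g(t_1,\dots,t_k)$ ($g\in\Sigma$, $t_i$ arithmetic expressions), $\varphi$ a constraint (guard). $\mathcal{TV}(\alpha)$ denotes the variables of $\alpha$ not in $\vec x$. An integer program is a finite set of rules in which $f_0$ does not occur on right-hand sides. Substitutions map variables to arithmetic expressions, applied homomorphically (also to multisets of terms elementwise); $f_2(\vec x)\mu=f_2(x_1\mu,\dots,x_k\mu)$; $\setminus$ removes one occurrence from a multiset. An integer substitution maps variables of its domain to integers; $\sigma\models\alpha$ means all variables of $\alpha$ are in $\mathrm{dom}(\sigma)$ and $\sigma$ models the guard. A configuration is a finite multiset of terms $f(n_1,\dots,n_k)$, $n_i\in\mathbb{Z}$. $S\xrightarrow{k}_{\mathcal{P}}T$ if there are $s\in S$, a rule $f(\vec x)\xrightarrow{c}Q\ [\varphi]$ in $\mathcal{P}$ and an integer substitution $\sigma$ covering the rule's variables with $f(\vec x)\sigma=s$, $\sigma\models\varphi$, $c\sigma=k$, $T=(S\setminus\{s\})\cup Q\sigma$ (equality modulo arithmetic); costs of sequences are summed. $\mathrm{dh}_{\mathcal{P}}(S)=\sup\{k\mid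 S\xrightarrow{k}{}^{*}_{\mathcal{P}}T\}$, $\mathrm{rc}_{\mathcal{P}}(n)=\sup\{\mathrm{dh}_{\mathcal{P}}(f_0(\vec n))\mid\vec n\in\mathbb{Z}^k,\sum_i|n_i|\leq n\}$. A rule $\alpha$ is well formed if $t_i\sigma\in\mathbb{Z}$ for all $f(t_1,\dots,t_k)\in\mathrm{rhs}(\alpha)$, all $i$ and all integer $\sigma\models\alpha$; a program is well formed if all its rules are. A processor is a partial function on integer programs; it is sound if $\mathrm{rc}_{\mathcal{P}}(n)\geq\mathrm{rc}_{\mathrm{proc}(\mathcal{P})}(n)$ for all $n\in\mathbb{N}$ and all $\mathcal{P}$ where it is defined.
   Formalization: The formal theorem adds the assumption that μ does not change the temporary variables of α2 (as when μ acts only on the program variables x); without it the claim fails, e.g. for α2: f2(x) → {g(tv)} and μ(tv) = 1/2. *)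

theory Defs
  imports Complex_Main "HOL-Library.Multiset" "HOL-Library.Extended_Real"
begin

section \<open>Arithmetic expressions and constraints\<close>

text \<open>
  The set of arithmetic operations is open-ended: besides the usual ones, \<open>Oper\<close> admits any
  (possibly partial) operation on the reals, with arguments given as a list.
\<close>

datatype (avars: 'v) aexp =
    Var 'v
  | Num real
  | Plus "'v aexp" "'v aexp"
  | Minus "'v aexp" "'v aexp"
  | Times "'v aexp" "'v aexp"
  | Div "'v aexp" "'v aexp"
  | Pow "'v aexp" "'v aexp"
  | Oper "real list \<Rightarrow> real option" "'v aexp list"

datatype cmp = Lt | Le | Gt | Ge

datatype (ineq_vars: 'v) ineq = Ineq cmp "'v aexp" "'v aexp"

text \<open>A list stands for the conjunction of its elements.\<close>

type_synonym 'v constraint = "'v ineq list"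

definition constraint_vars :: "'v constraint \<Rightarrow> 'v set" where
  "constraint_vars \<phi> = (\<Union>a\<in>set \<phi>. ineq_vars a)"

type_synonym 'v subst = "'v \<Rightarrow> 'v aexp option"

type_synonym 'v isubst = "'v \<Rightarrow> int option"

primrec asubst :: "'v subst \<Rightarrow> 'v aexp \<Rightarrow> 'v aexp" where
  "asubst \<mu> (Var v) = (case \<mu> v of None \<Rightarrow> Var v | Some e \<Rightarrow> e)"
| "asubst \<mu> (Num r) = Num r"
| "asubst \<mu> (Plus a b) = Plus (asubst \<mu> a) (asubst \<mu> b)"
| "asubst \<mu> (Minus a b) = Minus (asubst \<mu> a) (asubst \<mu> b)"
| "asubst \<mu> (Times a b) = Times (asubst \<mu> a) (asubst \<mu> b)"
| "asubst \<mu> (Div a b) = Div (asubst \<mu> a) (asubst \<mu> b)"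
| "asubst \<mu> (Pow a b) = Pow (asubst \<mu> a) (asubst \<mu> b)"
| "asubst \<mu> (Oper F es) = Oper F (map (asubst \<mu>) es)"

primrec ineq_subst :: "'v subst \<Rightarrow> 'v ineq \<Rightarrow> 'v ineq" where
  "ineq_subst \<mu> (Ineq r a b) = Ineq r (asubst \<mu> a) (asubst \<mu> b)"

definition constraint_subst :: "'v subst \<Rightarrow> 'v constraint \<Rightarrow> 'v constraint" where
  "constraint_subst \<mu> \<phi> = map (ineq_subst \<mu>) \<phi>"

text \<open>
  Evaluation is strict and partial: an expression has no value if it contains a variable outside
  the domain of \<open>\<sigma>\<close>, a division by zero, or a power that is not a real number.
\<close>

definition lift2 :: "(real \<Rightarrow> real \<Rightarrow> real option) \<Rightarrow> real option \<Rightarrow> real option \<Rightarrow> real option" where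
  "lift2 F x y = Option.bind x (\<lambda>a. Option.bind y (F a))"

definition real_div :: "real \<Rightarrow> real \<Rightarrow> real option" where
  "real_div a b = (if b = 0 then None else Some (a / b))"

definition real_pow :: "real \<Rightarrow> real \<Rightarrow> real option" where
  "real_pow a b =
     (if b \<in> \<int> then (if a \<noteq> 0 \<or> 0 \<le> b then Some (a powi \<lfloor>b\<rfloor>) else None)
      else if 0 < a \<or> a = 0 \<and> 0 < b then Some (a powr b)
      else None)"

primrec aeval :: "'v isubst \<Rightarrow> 'v aexp \<Rightarrow> real option" where
  "aeval \<sigma> (Var v) = map_option real_of_int (\<sigma> v)"
| "aeval \<sigma> (Num r) = Some r"
| "aeval \<sigma> (Plus a b) = lift2 (\<lambda>x y. Some (x + y)) (aeval \<sigma> a) (aeval \<sigma> b)"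
| "aeval \<sigma> (Minus a b) = lift2 (\<lambda>x y. Some (x - y)) (aeval \<sigma> a) (aeval \<sigma> b)"
| "aeval \<sigma> (Times a b) = lift2 (\<lambda>x y. Some (x * y)) (aeval \<sigma> a) (aeval \<sigma> b)"
| "aeval \<sigma> (Div a b) = lift2 real_div (aeval \<sigma> a) (aeval \<sigma> b)"
| "aeval \<sigma> (Pow a b) = lift2 real_pow (aeval \<sigma> a) (aeval \<sigma> b)"
| "aeval \<sigma> (Oper F es) = Option.bind (those (map (aeval \<sigma>) es)) F"

primrec cmp_rel :: "cmp \<Rightarrow> real \<Rightarrow> real \<Rightarrow> bool" where
  "cmp_rel Lt = (<)"
| "cmp_rel Le = (\<le>)"
| "cmp_rel Gt = (>)"
| "cmp_rel Ge = (\<ge>)"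

primrec ineq_holds :: "'v isubst \<Rightarrow> 'v ineq \<Rightarrow> bool" where
  "ineq_holds \<sigma> (Ineq r a b) \<longleftrightarrow>
     (\<exists>x y. aeval \<sigma> a = Some x \<and> aeval \<sigma> b = Some y \<and> cmp_rel r x y)"

definition constraint_holds :: "'v isubst \<Rightarrow> 'v constraint \<Rightarrow> bool" where
  "constraint_holds \<sigma> \<phi> \<longleftrightarrow> (\<forall>a\<in>set \<phi>. ineq_holds \<sigma> a)"


section \<open>Rules and integer programs\<close>

datatype (dead 'f, 'a) fterm = Fun (sym: 'f) (args: "'a list")

type_synonym ('f, 'v) aterm = "('f, 'v aexp) fterm"

type_synonym 'f config = "('f, int) fterm multiset"

definition term_subst :: "'v subst \<Rightarrow> ('f, 'v) aterm \<Rightarrow> ('f, 'v) aterm" where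
  "term_subst \<mu> t = map_fterm (asubst \<mu>) t"

definition term_vars :: "('f, 'v) aterm \<Rightarrow> 'v set" where
  "term_vars t = (\<Union>e\<in>set (args t). avars e)"

text \<open>
  The left-hand side of a rule is its root symbol applied to the fixed vector \<open>xs\<close> of program
  variables; only the symbol is stored. The common arity of all symbols is \<open>length xs\<close>.
\<close>

datatype ('f, 'v) rule =
  Rule (lhs_sym: 'f) (cost: "'v aexp") (rhs: "('f, 'v) aterm multiset") (guard: "'v constraint")

definition rule_vars :: "'v list \<Rightarrow> ('f, 'v) rule \<Rightarrow> 'v set" where
  "rule_vars xs \<alpha> =
     set xs \<union> avars (cost \<alpha>) \<union> (\<Union>t\<in>set_mset (rhs \<alpha>). term_vars t) \<union> constraint_vars (guard \<alpha>)"

definition temp_vars :: "'v list \<Rightarrow> ('f, 'v) rule \<Rightarrow> 'v set" where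
  "temp_vars xs \<alpha> = rule_vars xs \<alpha> - set xs"

definition program_signature :: "'f set \<Rightarrow> 'f \<Rightarrow> 'v list \<Rightarrow> bool" where
  "program_signature Sig f0 xs \<longleftrightarrow> finite Sig \<and> f0 \<in> Sig \<and> distinct xs"

definition integer_program :: "'f set \<Rightarrow> 'f \<Rightarrow> 'v list \<Rightarrow> ('f, 'v) rule set \<Rightarrow> bool" where
  "integer_program Sig f0 xs P \<longleftrightarrow>
     finite P \<and>
     (\<forall>\<alpha>\<in>P. lhs_sym \<alpha> \<in> Sig \<and>
        (\<forall>t\<in>set_mset (rhs \<alpha>). sym t \<in> Sig \<and> sym t \<noteq> f0 \<and> length (args t) = length xs))"

definition models_rule :: "'v list \<Rightarrow> 'v isubst \<Rightarrow> ('f, 'v) rule \<Rightarrow> bool" where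
  "models_rule xs \<sigma> \<alpha> \<longleftrightarrow> rule_vars xs \<alpha> \<subseteq> dom \<sigma> \<and> constraint_holds \<sigma> (guard \<alpha>)"

definition well_formed_rule :: "'v list \<Rightarrow> ('f, 'v) rule \<Rightarrow> bool" where
  "well_formed_rule xs \<alpha> \<longleftrightarrow>
     (\<forall>t\<in>set_mset (rhs \<alpha>). \<forall>e\<in>set (args t). \<forall>\<sigma>. models_rule xs \<sigma> \<alpha> \<longrightarrow>
        (\<exists>n::int. aeval \<sigma> e = Some (real_of_int n)))"

definition well_formed :: "'v list \<Rightarrow> ('f, 'v) rule set \<Rightarrow> bool" where
  "well_formed xs P \<longleftrightarrow> (\<forall>\<alpha>\<in>P. well_formed_rule xs \<alpha>)"


section \<open>Evaluation and runtime complexity\<close>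

text \<open>\<open>term_evals \<sigma> t s\<close>: the term \<open>t\<sigma>\<close> equals the integer term \<open>s\<close> modulo arithmetic.\<close>

definition term_evals :: "'v isubst \<Rightarrow> ('f, 'v) aterm \<Rightarrow> ('f, int) fterm \<Rightarrow> bool" where
  "term_evals \<sigma> = rel_fterm (\<lambda>e n. aeval \<sigma> e = Some (real_of_int n))"

definition step ::
  "'v list \<Rightarrow> ('f, 'v) rule set \<Rightarrow> 'f config \<Rightarrow> real \<Rightarrow> 'f config \<Rightarrow> bool" where
  "step xs P S k T \<longleftrightarrow>
     (\<exists>s \<alpha> \<sigma> Q. s \<in># S \<and> \<alpha> \<in> P \<and> models_rule xs \<sigma> \<alpha> \<and>
        term_evals \<sigma> (Fun (lhs_sym \<alpha>) (map Var xs)) s \<and>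
        aeval \<sigma> (cost \<alpha>) = Some k \<and>
        rel_mset (term_evals \<sigma>) (rhs \<alpha>) Q \<and>
        T = (S - {#s#}) + Q)"

inductive steps ::
  "'v list \<Rightarrow> ('f, 'v) rule set \<Rightarrow> 'f config \<Rightarrow> real \<Rightarrow> 'f config \<Rightarrow> bool"
  for xs :: "'v list" and P :: "('f, 'v) rule set" where
  refl: "steps xs P S 0 S"
| step: "step xs P S k T \<Longrightarrow> steps xs P T l U \<Longrightarrow> steps xs P S (k + l) U"

definition dh :: "'v list \<Rightarrow> ('f, 'v) rule set \<Rightarrow> 'f config \<Rightarrow> ereal" where
  "dh xs P S = Sup {ereal k | k T. steps xs P S k T}"

definition rc :: "'f \<Rightarrow> 'v list \<Rightarrow> ('f, 'v) rule set \<Rightarrow> nat \<Rightarrow> ereal" where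
  "rc f0 xs P n =
     Sup {dh xs P {#Fun f0 ns#} | ns. length ns = length xs \<and> (\<Sum>m\<leftarrow>ns. \<bar>m\<bar>) \<le> int n}"


section \<open>Processors\<close>

definition processor ::
  "'f set \<Rightarrow> 'f \<Rightarrow> 'v list \<Rightarrow> (('f, 'v) rule set \<Rightarrow> ('f, 'v) rule set option) \<Rightarrow> bool" where
  "processor Sig f0 xs proc \<longleftrightarrow>
     (\<forall>P P'. proc P = Some P' \<longrightarrow> integer_program Sig f0 xs P \<and> integer_program Sig f0 xs P')"

definition sound_processor ::
  "'f set \<Rightarrow> 'f \<Rightarrow> 'v list \<Rightarrow> (('f, 'v) rule set \<Rightarrow> ('f, 'v) rule set option) \<Rightarrow> bool" where
  "sound_processor Sig f0 xs proc \<longleftrightarrow>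
     processor Sig f0 xs proc \<and>
     (\<forall>P P'. proc P = Some P' \<longrightarrow> (\<forall>n. rc f0 xs P n \<ge> rc f0 xs P' n))"

end

theory Submission
  imports Defs
begin

text \<open>
  A step with the chained rule under \<open>\<sigma>\<close> splits into a step with \<open>\<alpha>1\<close> under an extension of \<open>\<sigma>\<close>,
  followed by a step with \<open>\<alpha>2\<close> that sends each program variable \<open>x\<close> to the value of \<open>x\<mu>\<close>; that
  value is an integer because \<open>\<alpha>1\<close> is well formed. The extension is needed since variables of
  \<open>\<alpha>1\<close> that occur only in the removed term \<open>f\<^sub>2(x)\<mu>\<close> may be lost in the chained rule.
\<close>

section \<open>Agreement and substitution properties of evaluation\<close>

lemma aeval_cong:
  assumes "\<And>v. v \<in> avars e \<Longrightarrow> \<sigma> v = \<tau> v"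
  shows "aeval \<sigma> e = aeval \<tau> e"
  using assms
proof (induction e)
  case (Oper F es)
  then have "map (aeval \<sigma>) es = map (aeval \<tau>) es"
    by (auto intro!: map_cong)
  then show ?case by (simp only: aeval.simps)
qed simp_all

text \<open>Evaluation and substitution are both homomorphic, so only the variables matter. Wrapping
  \<open>v\<close> in \<open>Var\<close> treats variables inside and outside
  \<open>dom \<mu>\<close> alike and compares undefined values too.\<close>

lemma aeval_asubst:
  assumes "\<And>v. v \<in> avars e \<Longrightarrow> aeval \<sigma> (asubst \<mu> (Var v)) = aeval \<tau> (Var v)"
  shows "aeval \<sigma> (asubst \<mu> e) = aeval \<tau> e"
  using assms
proof (induction e)
  case (Oper F es)
  then have "map (aeval \<sigma> \<circ> asubst \<mu>) es = map (aeval \<tau>) es"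
    by (auto intro!: map_cong)
  then show ?case by (simp only: aeval.simps asubst.simps map_map)
qed simp_all

lemma constraint_holds_append:
  "constraint_holds \<sigma> (\<phi> @ \<psi>) \<longleftrightarrow> constraint_holds \<sigma> \<phi> \<and> constraint_holds \<sigma> \<psi>"
  by (auto simp: constraint_holds_def)

text \<open>Agreement is assumed on expressions, not on variables, because
  \<open>chained_rule_models\<close> supplies its equations in that form. The same holds for the
  constraint and term versions below.\<close>

lemma ineq_holds_cong:
  assumes "\<And>e. avars e \<subseteq> ineq_vars a \<Longrightarrow> aeval \<sigma> e = aeval \<tau> e"
  shows "ineq_holds \<sigma> a \<longleftrightarrow> ineq_holds \<tau> a"
  using assms by (cases a) simp

lemma constraint_holds_cong:
  assumes "\<And>e. avars e \<subseteq> constraint_vars \<phi> \<Longrightarrow> aeval \<sigma> e = aeval \<tau> e"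
  shows "constraint_holds \<sigma> \<phi> \<longleftrightarrow> constraint_holds \<tau> \<phi>"
  unfolding constraint_holds_def
  by (intro ball_cong refl ineq_holds_cong assms) (auto simp: constraint_vars_def)

lemma constraint_holds_subst:
  assumes "\<And>e. avars e \<subseteq> constraint_vars \<phi> \<Longrightarrow> aeval \<sigma> (asubst \<mu> e) = aeval \<tau> e"
  shows "constraint_holds \<sigma> (constraint_subst \<mu> \<phi>) \<longleftrightarrow> constraint_holds \<tau> \<phi>"
proof -
  have "ineq_holds \<sigma> (ineq_subst \<mu> a) \<longleftrightarrow> ineq_holds \<tau> a" if "a \<in> set \<phi>" for a
  proof (cases a)
    case (Ineq r b c)
    have "avars b \<subseteq> constraint_vars \<phi>" "avars c \<subseteq> constraint_vars \<phi>"
      using that Ineq by (force simp: constraint_vars_def)+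
    then show ?thesis using assms Ineq by simp
  qed
  then show ?thesis by (auto simp: constraint_holds_def constraint_subst_def)
qed

lemma term_evals_cong:
  assumes "\<And>e. avars e \<subseteq> term_vars t \<Longrightarrow> aeval \<sigma> e = aeval \<tau> e"
  shows "term_evals \<sigma> t s \<longleftrightarrow> term_evals \<tau> t s"
proof (cases t; cases s)
  fix f es g ns assume eq: "t = Fun f es" "s = Fun g ns"
  have "aeval \<sigma> e = aeval \<tau> e" if "e \<in> set es" for e
    using assms that eq by (auto simp: term_vars_def)
  then show ?thesis
    by (auto simp: term_evals_def eq intro: list.rel_mono_strong)
qed

lemma term_evals_subst:
  assumes "\<And>e. avars e \<subseteq> term_vars t \<Longrightarrow> aeval \<sigma> (asubst \<mu> e) = aeval \<tau> e"
  shows "term_evals \<sigma> (term_subst \<mu> t) s \<longleftrightarrow> term_evals \<tau> t s"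
proof (cases t; cases s)
  fix f es g ns assume eq: "t = Fun f es" "s = Fun g ns"
  have "aeval \<sigma> (asubst \<mu> e) = aeval \<tau> e" if "e \<in> set es" for e
    using assms that eq by (auto simp: term_vars_def)
  then show ?thesis
    by (auto simp: term_evals_def term_subst_def eq list.rel_map intro: list.rel_mono_strong)
qed

text \<open>Separates what the remaining terms of \<alpha> evaluate to from what the right-hand side
  of \<beta> contributes. Induction on \<open>A\<close> peels off one related pair at a
  time.\<close>

lemma rel_mset_union_left:
  assumes "rel_mset R (A + B) C"
  obtains C1 C2 where "C = C1 + C2" "rel_mset R A C1" "rel_mset R B C2"
proof -
  have "\<exists>C1 C2. C = C1 + C2 \<and> rel_mset R A C1 \<and> rel_mset R B C2"
    using assms
  proof (induction A arbitrary: C)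
    case empty
    then show ?case by (intro exI[of _ "{#}"] exI[of _ C]) (simp add: rel_mset_Zero)
  next
    case (add a A)
    from add.prems have "rel_mset R (add_mset a (A + B)) C" by simp
    then obtain C' c where C: "C = add_mset c C'" "R a c" "rel_mset R (A + B) C'"
      by (auto dest: msed_rel_invL)
    with add.IH obtain C1 C2 where "C' = C1 + C2" "rel_mset R A C1" "rel_mset R B C2"
      by blast
    with C show ?case
      by (intro exI[of _ "add_mset c C1"] exI[of _ C2]) (auto intro: rel_mset_Plus)
  qed
  then show thesis using that by blast
qed

section \<open>The chained rule and its well-formedness\<close>

definition chained_rule ::
  "'v list \<Rightarrow> 'v subst \<Rightarrow> ('f, 'v) rule \<Rightarrow> ('f, 'v) rule \<Rightarrow> ('f, 'v) rule" where
  "chained_rule xs \<mu> \<alpha> \<beta> =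
     Rule (lhs_sym \<alpha>) (Plus (cost \<alpha>) (asubst \<mu> (cost \<beta>)))
       ((rhs \<alpha> - {#term_subst \<mu> (Fun (lhs_sym \<beta>) (map Var xs))#}) + image_mset (term_subst \<mu>) (rhs \<beta>))
       (guard \<alpha> @ constraint_subst \<mu> (guard \<beta>))"

lemma chained_rule_sel [simp]:
  "lhs_sym (chained_rule xs \<mu> \<alpha> \<beta>) = lhs_sym \<alpha>"
  "cost (chained_rule xs \<mu> \<alpha> \<beta>) = Plus (cost \<alpha>) (asubst \<mu> (cost \<beta>))"
  "rhs (chained_rule xs \<mu> \<alpha> \<beta>) =
     (rhs \<alpha> - {#term_subst \<mu> (Fun (lhs_sym \<beta>) (map Var xs))#}) + image_mset (term_subst \<mu>) (rhs \<beta>)"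
  "guard (chained_rule xs \<mu> \<alpha> \<beta>) = guard \<alpha> @ constraint_subst \<mu> (guard \<beta>)"
  by (simp_all add: chained_rule_def)

text \<open>The core of both claims: a model of the chained rule yields models of the two original
  rules. By the condition on \<open>dom \<mu>\<close>, \<mu> leaves the temporary variables of
  \<beta> alone, so composing \<mu> with \<sigma>1 only changes the program variables.\<close>

lemma chained_rule_models:
  fixes \<alpha> \<beta> :: "('f, 'v) rule"
  assumes wf: "well_formed_rule xs \<alpha>"
    and mem: "term_subst \<mu> (Fun (lhs_sym \<beta>) (map Var xs)) \<in># rhs \<alpha>"
    and dom: "dom \<mu> \<inter> temp_vars xs \<beta> = {}"
    and mod: "models_rule xs \<sigma> (chained_rule xs \<mu> \<alpha> \<beta>)"
  obtains \<sigma>1 \<sigma>2 where "models_rule xs \<sigma>1 \<alpha>" "models_rule xs \<sigma>2 \<beta>"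
    "\<And>e. avars e \<subseteq> rule_vars xs (chained_rule xs \<mu> \<alpha> \<beta>) \<Longrightarrow> aeval \<sigma>1 e = aeval \<sigma> e"
    "\<And>e. avars e \<subseteq> rule_vars xs \<beta> \<Longrightarrow> aeval \<sigma>1 (asubst \<mu> e) = aeval \<sigma>2 e"
proof -
  let ?\<gamma> = "chained_rule xs \<mu> \<alpha> \<beta>"
  have cov: "rule_vars xs ?\<gamma> \<subseteq> dom \<sigma>"
    and grd: "constraint_holds \<sigma> (guard \<alpha>)" "constraint_holds \<sigma> (constraint_subst \<mu> (guard \<beta>))"
    using mod by (auto simp: models_rule_def constraint_holds_append)
  \<comment> \<open>Variables of \<alpha> that disappear together with the removed term get the
    default 0, so that \<sigma>1 is total. The chained rule does not mention them.\<close>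
  define \<sigma>1 :: "'v isubst" where "\<sigma>1 v = Some (case \<sigma> v of None \<Rightarrow> 0 | Some n \<Rightarrow> n)" for v
  have dom1: "dom \<sigma>1 = UNIV" by (auto simp: \<sigma>1_def)
  have eq1: "aeval \<sigma>1 e = aeval \<sigma> e" if "avars e \<subseteq> rule_vars xs ?\<gamma>" for e
  proof (rule aeval_cong)
    fix v assume "v \<in> avars e"
    with that cov have "v \<in> dom \<sigma>" by blast
    then show "\<sigma>1 v = \<sigma> v" by (auto simp: \<sigma>1_def)
  qed
  have vars: "constraint_vars (guard \<alpha>) \<subseteq> rule_vars xs ?\<gamma>"
    "constraint_vars (constraint_subst \<mu> (guard \<beta>)) \<subseteq> rule_vars xs ?\<gamma>"
    by (auto simp: rule_vars_def constraint_vars_def)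
  have grd1: "constraint_holds \<sigma>1 (guard \<alpha>)"
    using grd(1) constraint_holds_cong[of "guard \<alpha>" \<sigma>1 \<sigma>] eq1 vars(1) by blast
  have grd2: "constraint_holds \<sigma>1 (constraint_subst \<mu> (guard \<beta>))"
    using grd(2) constraint_holds_cong[of "constraint_subst \<mu> (guard \<beta>)" \<sigma>1 \<sigma>] eq1 vars(2)
    by blast
  have mod1: "models_rule xs \<sigma>1 \<alpha>"
    using grd1 dom1 by (simp add: models_rule_def)
  have int: "\<exists>n::int. aeval \<sigma>1 (asubst \<mu> (Var x)) = Some (real_of_int n)" if "x \<in> set xs" for x
  proof -
    \<comment> \<open>The instance of \<open>x\<close> is an argument of the removed term, hence of
      a right-hand side term of the well-formed rule \<alpha>.\<close>
    have "asubst \<mu> (Var x) \<in> set (args (term_subst \<mu> (Fun (lhs_sym \<beta>) (map Var xs))))"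
      using that by (auto simp: term_subst_def simp del: asubst.simps)
    then show ?thesis
      using wf mem mod1 unfolding well_formed_rule_def by blast
  qed
  \<comment> \<open>This is \<mu> followed by \<sigma>1 on the program variables.
    \<open>floor\<close> only changes the type, as the value is already an integer by
    \<open>int\<close>.\<close>
  define \<sigma>2 where "\<sigma>2 v = (if v \<in> set xs then map_option floor (aeval \<sigma>1 (asubst \<mu> (Var v))) else \<sigma>1 v)" for v
  have dom2: "dom \<sigma>2 = UNIV"
    using int dom1 by (fastforce simp: \<sigma>2_def dom_def simp del: asubst.simps)
  have eq2: "aeval \<sigma>1 (asubst \<mu> e) = aeval \<sigma>2 e" if "avars e \<subseteq> rule_vars xs \<beta>" for e
  proof (rule aeval_asubst)
    fix v assume v: "v \<in> avars e"
    show "aeval \<sigma>1 (asubst \<mu> (Var v)) = aeval \<sigma>2 (Var v)"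
    proof (cases "v \<in> set xs")
      case True
      then show ?thesis using int[OF True] by (auto simp: \<sigma>2_def simp del: asubst.simps)
    next
      case False
      with v that dom have "\<mu> v = None" by (auto simp: temp_vars_def)
      with False show ?thesis by (simp add: \<sigma>2_def)
    qed
  qed
  have "constraint_vars (guard \<beta>) \<subseteq> rule_vars xs \<beta>" by (auto simp: rule_vars_def)
  then have "constraint_holds \<sigma>2 (guard \<beta>)"
    using grd2 constraint_holds_subst[of "guard \<beta>" \<sigma>1 \<mu> \<sigma>2] eq2 by blast
  then have "models_rule xs \<sigma>2 \<beta>"
    using dom2 by (simp add: models_rule_def)
  with mod1 eq1 eq2 show thesis using that by blast
qed

lemma avars_rhs_subset_rule_vars:
  assumes "t \<in># rhs \<alpha>" and "e \<in> set (args t)"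
  shows "avars e \<subseteq> rule_vars xs \<alpha>"
  using assms by (auto simp: rule_vars_def term_vars_def)

text \<open>Each right-hand side term comes from \<alpha>, and is integral under \<sigma>1, or is a
  \<mu>-instance of a term of \<beta>, whose arguments take the integer values given by \<sigma>2.
  Since \<sigma>1 and \<sigma> agree on the chained rule, this carries over to \<sigma>.\<close>

lemma well_formed_chained_rule:
  assumes wf1: "well_formed_rule xs \<alpha>" and wf2: "well_formed_rule xs \<beta>"
    and mem: "term_subst \<mu> (Fun (lhs_sym \<beta>) (map Var xs)) \<in># rhs \<alpha>"
    and dom: "dom \<mu> \<inter> temp_vars xs \<beta> = {}"
  shows "well_formed_rule xs (chained_rule xs \<mu> \<alpha> \<beta>)"
  unfolding well_formed_rule_def
proof (intro ballI allI impI)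
  fix t e \<sigma>
  assume t: "t \<in># rhs (chained_rule xs \<mu> \<alpha> \<beta>)" and e: "e \<in> set (args t)"
    and mod: "models_rule xs \<sigma> (chained_rule xs \<mu> \<alpha> \<beta>)"
  from chained_rule_models[OF wf1 mem dom mod] obtain \<sigma>1 \<sigma>2 where
    m: "models_rule xs \<sigma>1 \<alpha>" "models_rule xs \<sigma>2 \<beta>"
    and eq1: "\<And>e. avars e \<subseteq> rule_vars xs (chained_rule xs \<mu> \<alpha> \<beta>) \<Longrightarrow> aeval \<sigma>1 e = aeval \<sigma> e"
    and eq2: "\<And>e. avars e \<subseteq> rule_vars xs \<beta> \<Longrightarrow> aeval \<sigma>1 (asubst \<mu> e) = aeval \<sigma>2 e"
    by metis
  have "aeval \<sigma>1 e = aeval \<sigma> e"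
    using eq1 avars_rhs_subset_rule_vars[OF t e] by blast
  moreover have "\<exists>n::int. aeval \<sigma>1 e = Some (real_of_int n)"
  proof (cases "t \<in># rhs \<alpha>")
    case True
    then show ?thesis using wf1 e m(1) unfolding well_formed_rule_def by blast
  next
    case False
    with t obtain u where u: "u \<in># rhs \<beta>" "t = term_subst \<mu> u"
      by (auto dest: in_diffD)
    with e obtain d where d: "d \<in> set (args u)" "e = asubst \<mu> d"
      by (cases u) (auto simp: term_subst_def)
    have "aeval \<sigma>1 e = aeval \<sigma>2 d"
      using eq2 avars_rhs_subset_rule_vars[OF u(1) d(1)] d(2) by blast
    then show ?thesis using wf2 u d m(2) unfolding well_formed_rule_def by metis
  qed
  ultimately show "\<exists>n::int. aeval \<sigma> e = Some (real_of_int n)" by simp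
qed

lemma integer_program_chained_rule:
  fixes \<alpha> \<beta> :: "('f, 'v) rule"
  assumes "integer_program Sig f0 xs P" "\<alpha> \<in> P" "\<beta> \<in> P"
  shows "integer_program Sig f0 xs (P \<union> {chained_rule xs \<mu> \<alpha> \<beta>})"
proof -
  \<comment> \<open>Substitution keeps root symbols and arities, so the exclusion of
    \<open>f0\<close> and the arity condition are inherited.\<close>
  have "sym (term_subst \<mu> t) = sym t \<and> length (args (term_subst \<mu> t)) = length (args t)"
    for t :: "('f, 'v) aterm"
    by (cases t) (simp add: term_subst_def)
  with assms show ?thesis
    by (fastforce simp: integer_program_def dest: in_diffD)
qed

section \<open>Simulation of a chained step by two steps\<close>

text \<open>The intermediate configuration carries the value of the removed term, which the second
  step consumes at once. The singleton program isolates steps that use the new rule.\<close>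

lemma chained_step:
  fixes \<alpha> \<beta> :: "('f, 'v) rule"
  assumes wf: "well_formed_rule xs \<alpha>" and P: "\<alpha> \<in> P" "\<beta> \<in> P"
    and mem: "term_subst \<mu> (Fun (lhs_sym \<beta>) (map Var xs)) \<in># rhs \<alpha>"
    and dom: "dom \<mu> \<inter> temp_vars xs \<beta> = {}"
    and st: "step xs {chained_rule xs \<mu> \<alpha> \<beta>} S k U"
  shows "\<exists>k1 k2 V. step xs P S k1 V \<and> step xs P V k2 U \<and> k = k1 + k2"
proof -
  let ?\<gamma> = "chained_rule xs \<mu> \<alpha> \<beta>"
  let ?l = "Fun (lhs_sym \<beta>) (map Var xs)"
  let ?R = "rhs \<alpha> - {#term_subst \<mu> ?l#}"
  from st obtain s \<sigma> Q where s: "s \<in># S" and mod: "models_rule xs \<sigma> ?\<gamma>"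
    and lhs: "term_evals \<sigma> (Fun (lhs_sym \<alpha>) (map Var xs)) s"
    and cost: "aeval \<sigma> (cost ?\<gamma>) = Some k"
    and Q: "rel_mset (term_evals \<sigma>) (rhs ?\<gamma>) Q"
    and U: "U = S - {#s#} + Q"
    unfolding step_def by auto
  from chained_rule_models[OF wf mem dom mod] obtain \<sigma>1 \<sigma>2 where
    m: "models_rule xs \<sigma>1 \<alpha>" "models_rule xs \<sigma>2 \<beta>"
    and eq1: "\<And>e. avars e \<subseteq> rule_vars xs ?\<gamma> \<Longrightarrow> aeval \<sigma>1 e = aeval \<sigma> e"
    and eq2: "\<And>e. avars e \<subseteq> rule_vars xs \<beta> \<Longrightarrow> aeval \<sigma>1 (asubst \<mu> e) = aeval \<sigma>2 e"
    by metis
  have xs_vars: "term_vars (Fun f (map Var xs)) \<subseteq> rule_vars xs \<delta>" for f :: 'f and \<delta> :: "('f, 'v) rule"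
    by (auto simp: term_vars_def rule_vars_def)
  have rhs_vars: "term_vars t \<subseteq> rule_vars xs \<delta>" if "t \<in># rhs \<delta>" for t and \<delta> :: "('f, 'v) rule"
    using that by (auto simp: rule_vars_def)
  have lhs1: "term_evals \<sigma>1 (Fun (lhs_sym \<alpha>) (map Var xs)) s"
    using lhs term_evals_cong[of "Fun (lhs_sym \<alpha>) (map Var xs)" \<sigma>1 \<sigma>] eq1 xs_vars by blast
  have "rel_mset (term_evals \<sigma>1) (rhs ?\<gamma>) Q"
  proof (rule multiset.rel_mono_strong[OF Q])
    fix t q assume "t \<in># rhs ?\<gamma>" "term_evals \<sigma> t q"
    then show "term_evals \<sigma>1 t q"
      using term_evals_cong[of t \<sigma>1 \<sigma>] eq1 rhs_vars by blast
  qed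
  then obtain Q1 Q2 where Q12: "Q = Q1 + Q2" "rel_mset (term_evals \<sigma>1) ?R Q1"
    "rel_mset (term_evals \<sigma>1) (image_mset (term_subst \<mu>) (rhs \<beta>)) Q2"
    by (auto elim: rel_mset_union_left)
  from Q12(3) have "rel_mset (\<lambda>t. term_evals \<sigma>1 (term_subst \<mu> t)) (rhs \<beta>) Q2"
    by (simp add: multiset.rel_map)
  then have Q2: "rel_mset (term_evals \<sigma>2) (rhs \<beta>) Q2"
  proof (rule multiset.rel_mono_strong)
    fix t q assume "t \<in># rhs \<beta>" "term_evals \<sigma>1 (term_subst \<mu> t) q"
    then show "term_evals \<sigma>2 t q"
      using term_evals_subst[of t \<sigma>1 \<mu> \<sigma>2] eq2 rhs_vars by blast
  qed
  \<comment> \<open>The redex of the second step: both the left-hand side of \<beta> under \<sigma>2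
    and the removed term under \<sigma>1 evaluate to it. \<open>the\<close> is safe because
    \<sigma>2 covers \<open>xs\<close>.\<close>
  define s' where "s' = Fun (lhs_sym \<beta>) (map (\<lambda>x. the (\<sigma>2 x)) xs)"
  have "set xs \<subseteq> dom \<sigma>2" using m(2) by (auto simp: models_rule_def rule_vars_def)
  then have s'2: "term_evals \<sigma>2 ?l s'"
    by (auto simp: term_evals_def s'_def list.rel_map intro!: list.rel_refl_strong)
  then have s'1: "term_evals \<sigma>1 (term_subst \<mu> ?l) s'"
    using term_evals_subst[of ?l \<sigma>1 \<mu> \<sigma>2] eq2 xs_vars by blast
  \<comment> \<open>Putting the removed term back restores the full right-hand side of
    \<alpha>.\<close>
  have "rel_mset (term_evals \<sigma>1) (add_mset (term_subst \<mu> ?l) ?R) (add_mset s' Q1)"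
    using s'1 Q12(2) by (rule rel_mset_Plus)
  then have Q1: "rel_mset (term_evals \<sigma>1) (rhs \<alpha>) (add_mset s' Q1)"
    using mem by simp
  \<comment> \<open>Evaluation of \<open>Plus\<close> is strict, so both summands have
    values.\<close>
  from cost obtain k1 k2 where
    k: "aeval \<sigma> (cost \<alpha>) = Some k1" "aeval \<sigma> (asubst \<mu> (cost \<beta>)) = Some k2" "k = k1 + k2"
    by (auto simp: lift2_def bind_eq_Some_conv)
  have "aeval \<sigma>1 (cost \<alpha>) = Some k1"
    using k(1) eq1[of "cost \<alpha>"] by (auto simp: rule_vars_def)
  then have "step xs P S k1 (S - {#s#} + add_mset s' Q1)"
    unfolding step_def using s P(1) m(1) lhs1 Q1 by blast
  moreover
  have "avars (asubst \<mu> (cost \<beta>)) \<subseteq> rule_vars xs ?\<gamma>" "avars (cost \<beta>) \<subseteq> rule_vars xs \<beta>"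
    by (auto simp: rule_vars_def)
  then have "aeval \<sigma>2 (cost \<beta>) = Some k2"
    using k(2) eq1 eq2 by metis
  moreover have "U = S - {#s#} + add_mset s' Q1 - {#s'#} + Q2"
    using U Q12(1) by simp
  moreover have "s' \<in># S - {#s#} + add_mset s' Q1" by simp
  ultimately have "step xs P S k1 (S - {#s#} + add_mset s' Q1)"
    "step xs P (S - {#s#} + add_mset s' Q1) k2 U"
    unfolding step_def[of xs P "S - {#s#} + add_mset s' Q1"] using P(2) m(2) s'2 Q2 by blast+
  with k(3) show ?thesis by blast
qed

section \<open>From runs to runtime complexity\<close>

text \<open>One step may be simulated by a whole run, as the new rule needs two steps. Runs
  concatenate with added costs, which lifts this to runs of any length.\<close>

lemma steps_simulation:
  assumes sim: "\<And>S k T. step xs P' S k T \<Longrightarrow> steps xs P S k T"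
    and "steps xs P' S k T"
  shows "steps xs P S k T"
proof -
  have trans: "steps xs P S k T \<Longrightarrow> steps xs P T l U \<Longrightarrow> steps xs P S (k + l) U" for S k T l U
    by (induction rule: steps.induct) (auto simp: add.assoc intro: steps.step)
  show ?thesis
    using assms(2) by (induction rule: steps.induct) (auto intro: steps.refl trans sim)
qed

text \<open>Fewer runs mean fewer costs under the inner supremum, while the start configurations are
  the same.\<close>

lemma rc_mono:
  assumes "\<And>S k T. steps xs P' S k T \<Longrightarrow> steps xs P S k T"
  shows "rc f0 xs P' n \<le> rc f0 xs P n"
proof -
  have "dh xs P' S \<le> dh xs P S" for S
    unfolding dh_def by (rule Sup_subset_mono) (use assms in blast)
  then show ?thesis
    unfolding rc_def by (intro Sup_mono) blast
qed

lemma rc_chained_rule: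
  assumes wf: "well_formed_rule xs \<alpha>" and P: "\<alpha> \<in> P" "\<beta> \<in> P"
    and mem: "term_subst \<mu> (Fun (lhs_sym \<beta>) (map Var xs)) \<in># rhs \<alpha>"
    and dom: "dom \<mu> \<inter> temp_vars xs \<beta> = {}"
  shows "rc f0 xs (P \<union> {chained_rule xs \<mu> \<alpha> \<beta>}) n \<le> rc f0 xs P n"
proof (rule rc_mono, erule steps_simulation[rotated])
  fix S k T assume "step xs (P \<union> {chained_rule xs \<mu> \<alpha> \<beta>}) S k T"
  \<comment> \<open>The rule applied is either an old one or the new one.\<close>
  then consider "step xs P S k T" | "step xs {chained_rule xs \<mu> \<alpha> \<beta>} S k T"
    unfolding step_def by blast
  then show "steps xs P S k T"
  proof cases
    case 1
    then show ?thesis using steps.step[OF _ steps.refl] by fastforce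
  next
    case 2
    from chained_step[OF wf P mem dom 2] obtain k1 k2 V
      where "step xs P S k1 V" "step xs P V k2 T" "k = k1 + k2" by blast
    then show ?thesis
      \<comment> \<open>The run closes with \<open>refl\<close> at cost 0, giving
        \<open>k1 + (k2 + 0)\<close>.\<close>
      using steps.step[OF _ steps.step[OF _ steps.refl]] by fastforce
  qed
qed

theorem theorem4p11:
  fixes Sig :: "'f set" and f0 f1 f2 :: 'f and xs :: "'v list"
    and P P' :: "('f, 'v) rule set"
    and \<alpha>1 \<alpha>2 \<alpha>12 :: "('f, 'v) rule"
    and c1 c2 :: "'v aexp"
    and S T :: "('f, 'v) aterm multiset"
    and \<phi>1 \<phi>2 :: "'v constraint"
    and \<mu> :: "'v subst"
  assumes "program_signature Sig f0 xs"
    and "integer_program Sig f0 xs P"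
    and "well_formed xs P"
    and "\<alpha>1 \<in> P" and "\<alpha>2 \<in> P"
    and "\<alpha>1 = Rule f1 c1 S \<phi>1"
    and "term_subst \<mu> (Fun f2 (map Var xs)) \<in># S"
    and "\<alpha>2 = Rule f2 c2 T \<phi>2"
    and "temp_vars xs \<alpha>1 \<inter> temp_vars xs \<alpha>2 = {}"
    and "dom \<mu> \<inter> temp_vars xs \<alpha>2 = {}"
    and "\<alpha>12 = Rule f1 (Plus c1 (asubst \<mu> c2))
           ((S - {#term_subst \<mu> (Fun f2 (map Var xs))#}) + image_mset (term_subst \<mu>) T)
           (\<phi>1 @ constraint_subst \<mu> \<phi>2)"
    and "P' = P \<union> {\<alpha>12}"
  shows "well_formed xs P' \<and> sound_processor Sig f0 xs [P \<mapsto> P']"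
proof -
  have \<alpha>12: "\<alpha>12 = chained_rule xs \<mu> \<alpha>1 \<alpha>2"
    using assms by (simp add: chained_rule_def)
  have mem: "term_subst \<mu> (Fun (lhs_sym \<alpha>2) (map Var xs)) \<in># rhs \<alpha>1"
    using assms by simp
  have wf: "well_formed_rule xs \<alpha>1" "well_formed_rule xs \<alpha>2"
    using assms(3-5) by (auto simp: well_formed_def)
  have P': "P' = P \<union> {chained_rule xs \<mu> \<alpha>1 \<alpha>2}"
    using \<alpha>12 \<open>P' = P \<union> {\<alpha>12}\<close> by simp
  have "well_formed xs P'"
    using well_formed_chained_rule[OF wf mem assms(10)] assms(3) by (auto simp: well_formed_def P')
  moreover have "integer_program Sig f0 xs P'"
    unfolding P' using assms(2,4,5) by (rule integer_program_chained_rule)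
  moreover have "rc f0 xs P' n \<le> rc f0 xs P n" for n
    unfolding P' by (rule rc_chained_rule[OF wf(1) assms(4,5) mem assms(10)])
  \<comment> \<open>\<open>[P \<mapsto> P']\<close> is defined at \<open>P\<close> alone, so
    soundness concerns this one pair of programs.\<close>
  ultimately show ?thesis
    using assms(2) by (auto simp: sound_processor_def processor_def split: if_splits)
qed

end
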